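(* Let $\mathcal{T}$ be the set of real-valued time series of finite length, $\delta$ the dtw-distance on $\mathcal{T}$, $[x]=\{y\in\mathcal{T} : \delta(x,y)=0\}$ for $x\in\mathcal{T}$, and $\delta^*([x],[y])=\inf_{x'\in[x]}\inf_{y'\in[y]}\delta(x',y')$. Then the canonical extension $$\delta^\sim:\mathcal{T}\times\mathcal{T}\to\mathbb{R}_{\ge0},\qquad (x,y)\mapsto\delta^*([x],[y])$$ of the quotient distance $\delta^*$ is warping-invariant, that is, $\delta^\sim(x,y)=\delta^\sim(x',y')$ for all $x,y,x',y'\in\mathcal{T}$ such that $x$ and $x'$ have a common compression and $y$ and $y'$ have a common compression.
   Context: A (real-valued) time series is a finite sequence $x=(x_1,\dots,x_n)$ with $n\ge 1$ and $x_i\in\mathbb{R}$; its length is $|x|=n$. $\mathcal{T}$ is the set of all time series. A warping path of order $m\times n$ is a finite sequence $p=(p_1,\dots,p_\ell)$ of points $p_l=(i_l,j_l)\in\{1,\dots,m\}\times\{1,\dots,n\}$ with $p_1=(1,1)$, $p_\ell=(m,n)$ and $p_{l+1}-p_l\in\{(1,0),(0,1),(1,1)\}$ for $1\le l<\ell$. The dtw-distance of $x,y\in\mathcal{T}$ with $|x|=m$, $|y|=n$ is $\delta(x,y)=\min_p \big(\sum_{l=1}^{\ell}(x_{i_l}-y_{j_l})^2\big)^{1/2}$, the minimum being over all warping paths $p$ of order $m\times n$. Regard time series as words over the alphabet $\mathbb{R}$. For a word $v$ let $\mathcal{A}(v)$ be the set of elements occurring in $v$. A prime word is a word $a^n$ ($a$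 repeated $n$ times) with $a\in\mathbb{R}$, $n\ge1$. The prime factorization of $x$ is the (unique) sequence of prime words $p_1,\dots,p_k$ whose concatenation is $x$ and with $\mathcal{A}(p_t)\ne\mathcal{A}(p_{t+1})$ for $1\le t<k$. A word $x$ with prime factorization $p_1,\dots,p_k$ is an expansion of a word $x'$ with prime factorization $p'_1,\dots,p'_{k'}$, written $x\succ x'$ or $x'\prec x$ (and $x'$ is a compression of $x$), if $k=k'$, $\mathcal{A}(p_t)=\mathcal{A}(p'_t)$ and $|p_t|\ge|p'_t|$ for all $t$. A time series $z$ is a common compression of $x$ and $y$ if $z\prec x$ and $z\prec y$. *)

theory Defs
  imports "HOL-Analysis.Analysis"
begin

definition time_series :: "real list set" where
  "time_series = {x. x \<noteq> []}"


text \<open>Points of a warping path are 1-based. The step condition is written additively, because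
  subtraction on \<^typ>\<open>nat\<close> truncates.\<close>

definition warping_path :: "nat \<Rightarrow> nat \<Rightarrow> (nat \<times> nat) list \<Rightarrow> bool" where
  "warping_path m n p \<longleftrightarrow>
     p \<noteq> [] \<and> set p \<subseteq> {1..m} \<times> {1..n} \<and> hd p = (1, 1) \<and> last p = (m, n) \<and>
     (\<forall>l. Suc l < length p \<longrightarrow>
        p ! Suc l \<in> {p ! l + (1, 0), p ! l + (0, 1), p ! l + (1, 1)})"

definition path_cost :: "real list \<Rightarrow> real list \<Rightarrow> (nat \<times> nat) list \<Rightarrow> real" where
  "path_cost x y p = sqrt (\<Sum>(i, j)\<leftarrow>p. (x ! (i - 1) - y ! (j - 1))\<^sup>2)"

definition dtw :: "real list \<Rightarrow> real list \<Rightarrow> real" where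
  "dtw x y = Min (path_cost x y ` {p. warping_path (length x) (length y) p})"

text \<open>The minimum is over a finite nonempty set.\<close>

lemma finite_warping_paths: "finite {p. warping_path m n p}"
proof (rule finite_subset)
  show "{p. warping_path m n p} \<subseteq> {p. set p \<subseteq> {1..m} \<times> {1..n} \<and> distinct p}"
  proof safe
    fix p assume p: "warping_path m n p"
    have "sorted_wrt (\<lambda>a b. fst a + snd a < fst b + snd b) p"
    proof (subst sorted_wrt_iff_nth_Suc_transp)
      show "transp (\<lambda>a b::nat\<times>nat. fst a + snd a < fst b + snd b)"
        by (auto simp: transp_def)
      show "\<forall>i. Suc i < length p \<longrightarrow>
              fst (p ! i) + snd (p ! i) < fst (p ! Suc i) + snd (p ! Suc i)"
        using p unfolding warping_path_def by fastforce
    qed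
    then show "distinct p"
      by (induction p) auto
  qed (auto simp: warping_path_def)
  show "finite {p. set p \<subseteq> {1..m} \<times> {1..n} \<and> distinct p}"
    by (rule finite_subset_distinct) simp
qed

lemma warping_path_exists:
  assumes "1 \<le> m" "1 \<le> n"
  shows "{p. warping_path m n p} \<noteq> {}"
proof -
  define p where
    "p = map (\<lambda>k. if k < m then (Suc k, 1) else (m, Suc (Suc (k - m)))) [0..<m + n - 1]"
  have len: "length p = m + n - 1"
    by (simp add: p_def)
  have nth: "p ! k = (if k < m then (Suc k, 1) else (m, Suc (Suc (k - m))))" if "k < m + n - 1" for k
    using that by (simp add: p_def)
  have ne: "p \<noteq> []"
    using assms len by auto
  have "last p = (m, n)"
  proof -
    have "last p = p ! (m + n - 2)"
      using ne len by (simp add: last_conv_nth numeral_2_eq_2)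
    then show ?thesis
      using assms by (subst (asm) nth) auto
  qed
  moreover have "hd p = (1, 1)"
    using ne assms by (simp add: hd_conv_nth nth)
  moreover have "set p \<subseteq> {1..m} \<times> {1..n}"
    using assms by (auto simp: p_def split: if_splits)
  moreover have "p ! Suc l \<in> {p ! l + (1, 0), p ! l + (0, 1), p ! l + (1, 1)}"
    if "Suc l < length p" for l
    using that by (auto simp: len nth)
  ultimately have "warping_path m n p"
    using ne by (simp add: warping_path_def)
  then show ?thesis
    by blast
qed


definition dtw_class :: "real list \<Rightarrow> real list set" where
  "dtw_class x = {y \<in> time_series. dtw x y = 0}"

text \<open>The quotient distance is a function of two classes, that is, of two sets of time series.\<close>

definition quotient_dist :: "real list set \<Rightarrow> real list set \<Rightarrow> real" where
  "quotient_dist X Y = (INF x\<in>X. INF y\<in>Y. dtw x y)"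

definition canonical_ext :: "real list \<Rightarrow> real list \<Rightarrow> real" where
  "canonical_ext x y = quotient_dist (dtw_class x) (dtw_class y)"


definition prime_word :: "'a list \<Rightarrow> bool" where
  "prime_word w \<longleftrightarrow> (\<exists>a n. 1 \<le> n \<and> w = replicate n a)"

definition is_prime_factorization :: "'a list list \<Rightarrow> 'a list \<Rightarrow> bool" where
  "is_prime_factorization ps x \<longleftrightarrow>
     concat ps = x \<and> (\<forall>p\<in>set ps. prime_word p) \<and>
     (\<forall>t. Suc t < length ps \<longrightarrow> set (ps ! t) \<noteq> set (ps ! Suc t))"

definition expansion :: "'a list \<Rightarrow> 'a list \<Rightarrow> bool" where
  "expansion x x' \<longleftrightarrow>
     (\<exists>ps ps'. is_prime_factorization ps x \<and> is_prime_factorization ps' x' \<and>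
        length ps = length ps' \<and>
        (\<forall>t<length ps. set (ps ! t) = set (ps' ! t) \<and> length (ps ! t) \<ge> length (ps' ! t)))"

text \<open>The prime factorization exists and is unique, so the existential quantifiers in
  \<^const>\<open>expansion\<close> pick out the two factorizations.\<close>

lemma is_prime_factorization_Cons:
  "is_prime_factorization (p # ps) x \<longleftrightarrow>
     prime_word p \<and> (\<exists>y. x = p @ y \<and> is_prime_factorization ps y) \<and>
     (ps \<noteq> [] \<longrightarrow> set p \<noteq> set (hd ps))"
  by (auto simp: is_prime_factorization_def nth_Cons hd_conv_nth split: nat.splits)

lemma prime_factorization_hd:
  assumes "is_prime_factorization (p # ps) x"
  shows "p = takeWhile ((=) (hd x)) x" "is_prime_factorization ps (dropWhile ((=) (hd x)) x)"
proof -
  obtain y where y: "x = p @ y" "is_prime_factorization ps y"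
    and pw: "prime_word p" and ne: "ps \<noteq> [] \<longrightarrow> set p \<noteq> set (hd ps)"
    using assms by (auto simp: is_prime_factorization_Cons)
  obtain a n where a: "1 \<le> n" "p = replicate n a"
    using pw by (auto simp: prime_word_def)
  have hd: "hd x = a"
    using a y by (cases n) auto
  have "takeWhile ((=) a) y = [] \<and> dropWhile ((=) a) y = y"
  proof (cases ps)
    case Nil
    then show ?thesis
      using y by (simp add: is_prime_factorization_def)
  next
    case (Cons q qs)
    then obtain b k z where "1 \<le> k" "q = replicate k b" "y = q @ z"
      using y by (auto simp: is_prime_factorization_Cons prime_word_def)
    moreover from this have "a \<noteq> b"
      using a ne Cons by auto
    ultimately show ?thesis
      by (cases k) auto
  qed
  then show "p = takeWhile ((=) (hd x)) x" "is_prime_factorization ps (dropWhile ((=) (hd x)) x)"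
    using hd y a by (auto simp: takeWhile_append dropWhile_append)
qed

lemma prime_factorization_unique:
  assumes "is_prime_factorization ps x" "is_prime_factorization qs x"
  shows "ps = qs"
  using assms
proof (induction ps arbitrary: x qs)
  case Nil
  then show ?case
    by (cases qs) (auto simp: is_prime_factorization_def prime_word_def)
next
  case (Cons p ps)
  have "qs \<noteq> []"
    using Cons.prems by (auto simp: is_prime_factorization_def prime_word_def)
  then obtain q qs' where qs: "qs = q # qs'"
    by (cases qs) auto
  show ?case
    using prime_factorization_hd[OF Cons.prems(1)] prime_factorization_hd[of q qs' x]
      Cons.prems(2) Cons.IH unfolding qs by blast
qed

lemma prime_factorization_exists: "\<exists>ps. is_prime_factorization ps x"
proof (induction x)
  case Nil
  have "is_prime_factorization [] []"
    by (simp add: is_prime_factorization_def)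
  then show ?case
    by blast
next
  case (Cons a x)
  then obtain ps where ps: "is_prime_factorization ps x"
    by blast
  have pw: "prime_word [a]"
    unfolding prime_word_def by (intro exI[of _ a] exI[of _ 1]) simp
  show ?case
  proof (cases "ps \<noteq> [] \<and> set (hd ps) = {a}")
    case False
    then have "is_prime_factorization ([a] # ps) (a # x)"
      using ps pw by (auto simp: is_prime_factorization_Cons)
    then show ?thesis
      by blast
  next
    case True
    then obtain q qs where q: "ps = q # qs"
      by (cases ps) auto
    obtain b k where b: "1 \<le> k" "q = replicate k b"
      using ps q by (auto simp: is_prime_factorization_Cons prime_word_def)
    then have "b = a"
      using True q by auto
    then have "prime_word (a # q)"
      unfolding prime_word_def using b by (intro exI[of _ a] exI[of _ "Suc k"]) simp
    moreover have "set (a # q) = set q"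
      using True q by auto
    ultimately have "is_prime_factorization ((a # q) # qs) (a # x)"
      using ps q by (auto simp: is_prime_factorization_Cons)
    then show ?thesis
      by blast
  qed
qed

definition have_common_compression :: "real list \<Rightarrow> real list \<Rightarrow> bool" where
  "have_common_compression x y \<longleftrightarrow> (\<exists>z\<in>time_series. expansion x z \<and> expansion y z)"

definition warping_invariant :: "(real list \<Rightarrow> real list \<Rightarrow> real) \<Rightarrow> bool" where
  "warping_invariant d \<longleftrightarrow>
     (\<forall>x\<in>time_series. \<forall>y\<in>time_series. \<forall>x'\<in>time_series. \<forall>y'\<in>time_series.
        have_common_compression x x' \<and> have_common_compression y y' \<longrightarrow> d x y = d x' y')"

end

theory Submission
  imports Defs
begin

(* Two time series have dtw-distance 0 exactly when they coincide after collapsing runs of equal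
   adjacent elements: a path of cost 0 lists both series, up to repetitions, and conversely two
   series with the same collapse can be aligned run by run. Collapsing is the passage to the word
   with all prime factors of length 1, so series with a common compression have the same collapse
   and hence literally the same class, on which the canonical extension depends. *)

section \<open>Collapsing series read along a warping path\<close>

lemma remdups_adj_map_remdups_adj: "remdups_adj (map f (remdups_adj xs)) = remdups_adj (map f xs)"
proof (induction xs rule: remdups_adj.induct)
  case (3 x y xs)
  \<comment> \<open>When \<open>x\<close> and \<open>y\<close> differ, the collapsed tail still
    starts with \<open>y\<close>, so \<open>f x\<close> is compared with \<open>f y\<close> on both
    sides.\<close>
  have "hd (remdups_adj (y # xs)) = y"
    by simp
  then obtain zs where "remdups_adj (y # xs) = y # zs"
    by (cases "remdups_adj (y # xs)") auto
  with 3 show ?case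
    by (auto split: if_splits)
qed auto

text \<open>An index list that moves by 0 or 1 skips no value and never returns to one, so dropping
  repetitions leaves a full interval.\<close>

lemma remdups_adj_unit_steps:
  fixes q :: "nat list"
  assumes "q \<noteq> []" "\<And>l. Suc l < length q \<Longrightarrow> q ! Suc l = q ! l \<or> q ! Suc l = Suc (q ! l)"
  shows "hd q \<le> last q \<and> remdups_adj q = [hd q..<Suc (last q)]"
  using assms
proof (induction q rule: remdups_adj.induct)
  case (3 a b q)
  have step: "b = a \<or> b = Suc a"
    using "3.prems"(2)[of 0] by simp
  have "(b # q) ! Suc l = (b # q) ! l \<or> (b # q) ! Suc l = Suc ((b # q) ! l)"
    if "Suc l < length (b # q)" for l
    using "3.prems"(2)[of "Suc l"] that by simp
  \<comment> \<open>The recursion continues on \<open>a # q\<close> or on \<open>b # q\<close>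
    according to whether \<open>a = b\<close>; either way this list is \<open>b # q\<close>.\<close>
  then have IH: "b \<le> last (b # q)" "remdups_adj (b # q) = [b..<Suc (last (b # q))]"
    using "3.IH" by (cases "a = b"; force)+
  show ?case
    using step
  proof
    assume "b = Suc a"
    then show ?thesis
      using IH by (simp add: upt_conv_Cons)
  qed (use IH in simp)
qed auto

text \<open>The index list collapses to \<open>[1..<Suc (length x)]\<close>, along which
  \<open>x\<close> reads as itself; collapsing the indices first does not change the final
  collapse.\<close>

lemma remdups_adj_map_unit_steps:
  assumes "q \<noteq> []" "hd q = 1" "last q = length x"
    and "\<And>l. Suc l < length q \<Longrightarrow> q ! Suc l = q ! l \<or> q ! Suc l = Suc (q ! l)"
  shows "remdups_adj (map (\<lambda>i. x ! (i - 1)) q) = remdups_adj x"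
proof -
  have "map (\<lambda>i. x ! (i - 1)) [1..<Suc (length x)] = x"
    by (rule nth_equalityI) (auto simp del: upt_Suc)
  moreover have "remdups_adj q = [1..<Suc (length x)]"
    using remdups_adj_unit_steps[OF assms(1,4)] assms(2,3) by simp
  ultimately show ?thesis
    using remdups_adj_map_remdups_adj[of "\<lambda>i. x ! (i - 1)" q] by simp
qed

text \<open>Every step of a warping path raises each coordinate by 0 or 1, so the result on unit
  steps applies to \<open>map fst p\<close> and \<open>map snd p\<close>.\<close>

lemma warping_path_remdups_adj:
  assumes "warping_path (length x) (length y) p"
  shows "remdups_adj (map (\<lambda>(i, j). x ! (i - 1)) p) = remdups_adj x"
    and "remdups_adj (map (\<lambda>(i, j). y ! (j - 1)) p) = remdups_adj y"
proof -
  have step: "p ! Suc l \<in> {p ! l + (1, 0), p ! l + (0, 1), p ! l + (1, 1)}"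
    if "Suc l < length p" for l
    using assms that unfolding warping_path_def by blast
  have ends: "p \<noteq> []" "hd p = (1, 1)" "last p = (length x, length y)"
    using assms by (auto simp: warping_path_def)
  have "remdups_adj (map (\<lambda>i. x ! (i - 1)) (map fst p)) = remdups_adj x"
    using ends step by (intro remdups_adj_map_unit_steps) (fastforce simp: hd_map last_map)+
  then show "remdups_adj (map (\<lambda>(i, j). x ! (i - 1)) p) = remdups_adj x"
    by (simp add: case_prod_unfold comp_def)
  have "remdups_adj (map (\<lambda>j. y ! (j - 1)) (map snd p)) = remdups_adj y"
    using ends step by (intro remdups_adj_map_unit_steps) (fastforce simp: hd_map last_map)+
  then show "remdups_adj (map (\<lambda>(i, j). y ! (j - 1)) p) = remdups_adj y"
    by (simp add: case_prod_unfold comp_def)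
qed

section \<open>Construction of paths of cost zero\<close>

lemma warping_path_snoc:
  assumes "warping_path m n p" "(m', n') \<in> {(Suc m, n), (m, Suc n), (Suc m, Suc n)}"
  shows "warping_path m' n' (p @ [(m', n')])"
proof -
  have p: "p \<noteq> []" "set p \<subseteq> {1..m} \<times> {1..n}" "hd p = (1, 1)" "last p = (m, n)"
    and step: "\<And>l. Suc l < length p \<Longrightarrow>
      p ! Suc l \<in> {p ! l + (1, 0), p ! l + (0, 1), p ! l + (1, 1)}"
    using assms(1) unfolding warping_path_def by blast+
  \<comment> \<open>Both orders are positive, which keeps the new point inside the grid even when
    one coordinate stays unchanged.\<close>
  have "(1, 1) \<in> set p"
    using p by (metis hd_in_set)
  then have "1 \<le> m" "1 \<le> n"
    using p by auto
  moreover have "(p @ [(m', n')]) ! Suc l \<in>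
      {(p @ [(m', n')]) ! l + (1, 0), (p @ [(m', n')]) ! l + (0, 1), (p @ [(m', n')]) ! l + (1, 1)}"
    if "Suc l < length (p @ [(m', n')])" for l
  proof (cases "Suc l < length p")
    case True
    then show ?thesis
      using step[of l] by (simp add: nth_append)
  next
    case False
    \<comment> \<open>The only new step leads from \<open>last p\<close>, which is
      \<open>(m, n)\<close>, to the appended point.\<close>
    then have "l = length p - 1" "Suc l = length p" "l < length p"
      using that by auto
    then show ?thesis
      using p assms(2) by (auto simp: nth_append last_conv_nth)
  qed
  ultimately show ?thesis
    using p assms(2) unfolding warping_path_def by fastforce
qed

text \<open>This is the existence of a path of cost zero, phrased by equality of entries instead of
  squares and roots.\<close>

definition zero_aligned :: "'a list \<Rightarrow> 'a list \<Rightarrow> bool" where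
  "zero_aligned x y \<longleftrightarrow>
     (\<exists>p. warping_path (length x) (length y) p \<and> (\<forall>(i, j)\<in>set p. x ! (i - 1) = y ! (j - 1)))"

text \<open>The three choices of \<open>(u, v)\<close> mirror the three admissible steps. Appending
  at the end leaves the entries at old path points unchanged, and the new point pairs the two last
  entries.\<close>

lemma zero_aligned_append:
  assumes "zero_aligned x y" "(u, v) \<in> {([a], []), ([], [a]), ([a], [a])}"
    and "last (x @ u) = last (y @ v)"
  shows "zero_aligned (x @ u) (y @ v)"
proof -
  obtain p where p: "warping_path (length x) (length y) p"
      "\<And>i j. (i, j) \<in> set p \<Longrightarrow> x ! (i - 1) = y ! (j - 1)"
    using assms(1) by (auto simp: zero_aligned_def)
  let ?e = "(length (x @ u), length (y @ v))"
  have path: "warping_path (length (x @ u)) (length (y @ v)) (p @ [?e])"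
    using p(1) assms(2) by (intro warping_path_snoc) auto
  have sub: "set p \<subseteq> {1..length x} \<times> {1..length y}" "p \<noteq> []"
    using p(1) by (auto simp: warping_path_def)
  have "x \<noteq> []" "y \<noteq> []"
    using sub by (cases p; force)+
  then have "(x @ u) ! (length (x @ u) - 1) = (y @ v) ! (length (y @ v) - 1)"
    using assms(3) last_conv_nth[of "x @ u"] last_conv_nth[of "y @ v"] by simp
  moreover have "(x @ u) ! (i - 1) = (y @ v) ! (j - 1)" if "(i, j) \<in> set p" for i j
  proof -
    have "1 \<le> i" "i \<le> length x" "1 \<le> j" "j \<le> length y"
      using sub that by auto
    then have "i - 1 < length x" "j - 1 < length y"
      by linarith+
    then show ?thesis
      using p(2)[OF that] by (simp add: nth_append)
  qed
  ultimately have "\<forall>(i, j)\<in>set (p @ [?e]). (x @ u) ! (i - 1) = (y @ v) ! (j - 1)"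
    by auto
  with path show ?thesis
    unfolding zero_aligned_def by blast
qed

text \<open>\<open>remdups_adj\<close> recurses from the front, whereas the paths here grow at the
  end.\<close>

lemma remdups_adj_snoc:
  "remdups_adj (xs @ [a]) =
     (if xs \<noteq> [] \<and> last xs = a then remdups_adj xs else remdups_adj xs @ [a])"
proof (cases xs rule: rev_cases)
  case (snoc ys b)
  then show ?thesis
    using remdups_adj_append_two[of ys b a] by auto
qed simp

text \<open>Both series end in the same letter. A repeated last letter is removed from a series that
  has one; if neither has, the last letter is removed from both. A path for the shorter pair is then
  extended by the matching step.\<close>

lemma zero_aligned_if_remdups_adj_eq:
  assumes "remdups_adj x = remdups_adj y" "x \<noteq> []"
  shows "zero_aligned x y"
  using assms
proof (induction "length x + length y" arbitrary: x y rule: less_induct)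
  case less
  obtain x' a where x: "x = x' @ [a]"
    using less.prems by (metis rev_exhaust)
  have "y \<noteq> []"
    using less.prems by auto
  moreover have "last y = a"
    using less.prems x by (metis last_remdups_adj last_snoc)
  ultimately obtain y' where y: "y = y' @ [a]"
    by (metis append_butlast_last_id)
  consider "x' \<noteq> []" "last x' = a" | "y' \<noteq> []" "last y' = a"
    | "x' = [] \<or> last x' \<noteq> a" "y' = [] \<or> last y' \<noteq> a"
    by blast
  then show ?case
  proof cases
    case 1
    then have "zero_aligned x' y"
      using less x by (auto simp: remdups_adj_snoc)
    then show ?thesis
      using zero_aligned_append[of x' y "[a]" "[]" a] x y by simp
  next
    case 2
    then have "zero_aligned x y'"
      using less y by (auto simp: remdups_adj_snoc)
    then show ?thesis
      using zero_aligned_append[of x y' "[]" "[a]" a] x y by simp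
  next
    case 3
    \<comment> \<open>Neither series ends in a repetition, so both collapses end in a separate
      \<open>a\<close>, which cancels.\<close>
    then have eq: "remdups_adj x' = remdups_adj y'"
      using less.prems x y by (auto simp: remdups_adj_snoc split: if_splits)
    show ?thesis
    proof (cases "x' = []")
      case True
      then have "y' = []"
        using eq by (metis remdups_adj_Nil_iff)
      \<comment> \<open>Base case: both series equal \<open>[a]\<close>, and the path is a single
        point.\<close>
      moreover have "warping_path 1 1 [(1, 1)]"
        by (simp add: warping_path_def)
      ultimately show ?thesis
        using True x y unfolding zero_aligned_def by (intro exI[of _ "[(1, 1)]"]) simp
    next
      case False
      then have "zero_aligned x' y'"
        using less.hyps[of x' y'] eq x y by simp
      then show ?thesis
        using zero_aligned_append[of x' y' "[a]" "[a]" a] x y by simp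
    qed
  qed
qed

section \<open>Distance zero as equality of collapses\<close>

lemma path_cost_eq_0_iff:
  "path_cost x y p = 0 \<longleftrightarrow> (\<forall>(i, j)\<in>set p. x ! (i - 1) = y ! (j - 1))"
  unfolding path_cost_def
  by (subst real_sqrt_eq_zero_cancel_iff, subst sum_list_nonneg_eq_0_iff) auto

lemma path_cost_nonneg: "0 \<le> path_cost x y p"
  unfolding path_cost_def by (intro real_sqrt_ge_zero sum_list_nonneg) auto

lemma finite_path_costs: "finite (path_cost x y ` {p. warping_path (length x) (length y) p})"
  by (intro finite_imageI finite_warping_paths)

text \<open>The minimum in \<open>dtw\<close> runs over a finite set, nonempty because both series
  have positive length.\<close>

lemma dtw_attained:
  assumes "x \<in> time_series" "y \<in> time_series"
  obtains p where "warping_path (length x) (length y) p" "dtw x y = path_cost x y p"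
proof -
  have "{p. warping_path (length x) (length y) p} \<noteq> {}"
    using assms by (intro warping_path_exists) (auto simp: time_series_def Suc_le_eq)
  then have "dtw x y \<in> path_cost x y ` {p. warping_path (length x) (length y) p}"
    unfolding dtw_def by (intro Min_in finite_path_costs) auto
  then show ?thesis
    using that by auto
qed

lemma dtw_nonneg: "x \<in> time_series \<Longrightarrow> y \<in> time_series \<Longrightarrow> 0 \<le> dtw x y"
  by (metis dtw_attained path_cost_nonneg)

lemma dtw_eq_0_iff:
  assumes "x \<in> time_series" "y \<in> time_series"
  shows "dtw x y = 0 \<longleftrightarrow> remdups_adj x = remdups_adj y"
proof
  assume "dtw x y = 0"
  then obtain p where p: "warping_path (length x) (length y) p" "path_cost x y p = 0"
    using dtw_attained[OF assms] by metis
  \<comment> \<open>Cost zero makes the readings of \<open>x\<close> and \<open>y\<close> along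
    \<open>p\<close> agree entry by entry; their collapses are those of \<open>x\<close> and
    \<open>y\<close>.\<close>
  then have "map (\<lambda>(i, j). x ! (i - 1)) p = map (\<lambda>(i, j). y ! (j - 1)) p"
    by (auto simp: path_cost_eq_0_iff)
  then show "remdups_adj x = remdups_adj y"
    using warping_path_remdups_adj[OF p(1)] by metis
next
  assume "remdups_adj x = remdups_adj y"
  then have "zero_aligned x y"
    using assms by (intro zero_aligned_if_remdups_adj_eq) (auto simp: time_series_def)
  then obtain p where "warping_path (length x) (length y) p" "path_cost x y p = 0"
    by (auto simp: zero_aligned_def path_cost_eq_0_iff)
  then have "dtw x y \<le> 0"
    unfolding dtw_def using finite_path_costs by (intro Min_le) (auto simp: image_iff)
  then show "dtw x y = 0"
    using dtw_nonneg[OF assms] by simp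
qed

lemma dtw_class_eq:
  "x \<in> time_series \<Longrightarrow> dtw_class x = {y \<in> time_series. remdups_adj x = remdups_adj y}"
  by (auto simp: dtw_class_def dtw_eq_0_iff)

section \<open>Prime factorizations and expansions\<close>

lemma prime_word_set: "prime_word p \<Longrightarrow> set p = {hd p}"
  by (auto simp: prime_word_def)

text \<open>Each prime factor collapses to its single letter, and neighbouring factors have
  different letters, so nothing merges across a boundary.\<close>

lemma remdups_adj_prime_factorization:
  "is_prime_factorization ps x \<Longrightarrow> remdups_adj x = map hd ps"
proof (induction ps arbitrary: x)
  case Nil
  then show ?case
    by (simp add: is_prime_factorization_def)
next
  case (Cons p ps)
  then obtain y where pw: "prime_word p" and y: "x = p @ y" "is_prime_factorization ps y"
    and ne: "ps \<noteq> [] \<longrightarrow> set p \<noteq> set (hd ps)"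
    by (auto simp: is_prime_factorization_Cons)
  have IH: "remdups_adj y = map hd ps"
    using Cons.IH y by simp
  obtain a n where a: "1 \<le> n" "p = replicate n a"
    using pw by (auto simp: prime_word_def)
  \<comment> \<open>Collapses concatenate when the letters at the junction differ;
    \<open>hd y\<close> is the letter of the factor that follows \<open>p\<close>.\<close>
  have "last p \<noteq> hd y" if "y \<noteq> []"
  proof -
    have "ps \<noteq> []"
      using that IH by auto
    then have hd: "hd y = hd (hd ps)"
      using IH by (metis hd_map hd_remdups_adj)
    have "prime_word (hd ps)"
      using y(2) \<open>ps \<noteq> []\<close> by (simp add: is_prime_factorization_def)
    then show ?thesis
      using hd ne \<open>ps \<noteq> []\<close> a prime_word_set[of "hd ps"] by auto
  qed
  then have "remdups_adj x = remdups_adj p @ remdups_adj y"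
    using y by (auto intro!: remdups_adj_append')
  then show ?case
    using IH a by (simp add: remdups_adj_replicate)
qed

text \<open>Corresponding prime factors have the same one-element alphabet, hence the same letter,
  and these letters in order form the collapse.\<close>

lemma expansion_remdups_adj:
  assumes "expansion x x'"
  shows "remdups_adj x = remdups_adj x'"
proof -
  obtain ps ps' where ps: "is_prime_factorization ps x" "is_prime_factorization ps' x'"
      "length ps = length ps'" "\<And>t. t < length ps \<Longrightarrow> set (ps ! t) = set (ps' ! t)"
    using assms unfolding expansion_def by blast
  have "hd (ps ! t) = hd (ps' ! t)" if "t < length ps" for t
  proof -
    have "prime_word (ps ! t)" "prime_word (ps' ! t)"
      using ps that by (auto simp: is_prime_factorization_def)
    then show ?thesis
      using ps(4)[OF that] prime_word_set by (metis singleton_inject)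
  qed
  then have "map hd ps = map hd ps'"
    using ps(3) by (intro nth_equalityI) auto
  then show ?thesis
    using ps(1,2) by (simp add: remdups_adj_prime_factorization)
qed

section \<open>Classes and the canonical extension\<close>

lemma dtw_class_eq_if_common_compression:
  assumes "x \<in> time_series" "x' \<in> time_series" "have_common_compression x x'"
  shows "dtw_class x = dtw_class x'"
proof -
  have "remdups_adj x = remdups_adj x'"
    using assms(3) by (auto simp: have_common_compression_def dest!: expansion_remdups_adj)
  then show ?thesis
    using assms by (simp add: dtw_class_eq)
qed

lemma canonical_ext_nonneg:
  assumes "x \<in> time_series" "y \<in> time_series"
  shows "0 \<le> canonical_ext x y"
proof -
  \<comment> \<open>Each series lies in its own class; both infima thus run over nonempty sets, as a
    lower bound for a real infimum requires.\<close>
  have "x \<in> dtw_class x" "y \<in> dtw_class y"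
    using assms by (auto simp: dtw_class_eq)
  moreover have "0 \<le> dtw x' y'" if "x' \<in> dtw_class x" "y' \<in> dtw_class y" for x' y'
    using that by (auto simp: dtw_class_def intro: dtw_nonneg)
  ultimately show ?thesis
    unfolding canonical_ext_def quotient_dist_def by (intro cINF_greatest) auto
qed

theorem theorem29:
  shows "(\<forall>x\<in>time_series. \<forall>y\<in>time_series. 0 \<le> canonical_ext x y) \<and>
         warping_invariant canonical_ext"
proof
  show "\<forall>x\<in>time_series. \<forall>y\<in>time_series. 0 \<le> canonical_ext x y"
    by (simp add: canonical_ext_nonneg)
  show "warping_invariant canonical_ext"
    unfolding warping_invariant_def canonical_ext_def
  proof (intro ballI impI)
    fix x y x' y'
    assume "x \<in> time_series" "y \<in> time_series" "x' \<in> time_series" "y' \<in> time_series"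
      and "have_common_compression x x' \<and> have_common_compression y y'"
    \<comment> \<open>The extension sees its arguments only through their classes, so equality of
      the classes as sets suffices.\<close>
    then have "dtw_class x = dtw_class x'" "dtw_class y = dtw_class y'"
      by (simp_all add: dtw_class_eq_if_common_compression)
    then show "quotient_dist (dtw_class x) (dtw_class y) =
        quotient_dist (dtw_class x') (dtw_class y')"
      by simp
  qed
qed

end
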